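(* Let $n \ge 4$ be an even integer and let $G$ be a finite solvable group whose character degree graph $\Delta(G)$ has exactly $n$ vertices and is $(n-2)$-regular. Then the Laplacian spectrum of $\Delta(G)$ is $$\begin{pmatrix} 0 & n-2 & n\\ 1 & \frac n2 & \frac n2-1\end{pmatrix}.$$
   Context: For a finite group $G$, $\mathrm{Irr}(G)$ is the set of complex irreducible characters of $G$, $\mathrm{cd}(G)=\{\chi(1) : \chi\in \mathrm{Irr}(G)\}$, and $\rho(G)$ is the set of primes dividing some element of $\mathrm{cd}(G)$. The character degree graph $\Delta(G)$ is the simple undirected graph with vertex set $\rho(G)$ in which distinct primes $p,q$ are adjacent if and only if $pq$ divides some $r\in \mathrm{cd}(G)$. The Laplacian matrix of a finite simple graph $\Gamma$ is $L(\Gamma)=D(\Gamma)-A(\Gamma)$, with $D(\Gamma)$ the diagonal matrix of vertex degrees and $A(\Gamma)$ the adjacency matrix; the Laplacian spectrum is the spectrum of $L(\Gamma)$, displayed as a two-row array with eigenvalues in the first row and their multiplicities in the second row. *)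

theory Defs
  imports
    "HOL-Algebra.Solvable_Groups"
    "HOL-Computational_Algebra.Primes"
    "Jordan_Normal_Form.Spectral_Radius"
    "Graph_Theory.Graph_Theory"
begin

definition GL :: "nat \<Rightarrow> complex mat monoid" where
  "GL d = units_of (ring_mat TYPE(complex) d ())"

text \<open>Irreducibility: positive dimension, and no invariant subspaces besides the trivial two.\<close>

definition irreducible_rep ::
    "('a, 'b) monoid_scheme \<Rightarrow> nat \<Rightarrow> ('a \<Rightarrow> complex mat) \<Rightarrow> bool" where
  "irreducible_rep G d R \<longleftrightarrow>
     d > 0 \<and> R \<in> hom G (GL d) \<and>
     (\<forall>W. VectorSpace.subspace class_ring W (module_vec TYPE(complex) d) \<and>
          (\<forall>g\<in>carrier G. \<forall>v\<in>W. R g *\<^sub>v v \<in> W) \<longrightarrow>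
          W = {0\<^sub>v d} \<or> W = carrier_vec d)"

definition mat_trace :: "'a::comm_monoid_add mat \<Rightarrow> 'a" where
  "mat_trace A = (\<Sum>i<dim_row A. A $$ (i, i))"

definition rep_character ::
    "('a, 'b) monoid_scheme \<Rightarrow> ('a \<Rightarrow> complex mat) \<Rightarrow> 'a \<Rightarrow> complex" where
  "rep_character G R = restrict (\<lambda>g. mat_trace (R g)) (carrier G)"

definition Irr :: "('a, 'b) monoid_scheme \<Rightarrow> ('a \<Rightarrow> complex) set" where
  "Irr G = {rep_character G R | R d. irreducible_rep G d R}"

text \<open>The value of a character at \<open>\<one>\<close> is the dimension of the representation
  (see \<open>cd_eq\<close> below), so reading it as a natural number loses nothing.\<close>

definition cd :: "('a, 'b) monoid_scheme \<Rightarrow> nat set" where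
  "cd G = {m. \<exists>\<chi>\<in>Irr G. \<chi> \<one>\<^bsub>G\<^esub> = of_nat m}"

definition degree_primes :: "('a, 'b) monoid_scheme \<Rightarrow> nat set" where
  "degree_primes G = {p. prime p \<and> (\<exists>r\<in>cd G. p dvd r)}"

text \<open>An undirected edge is represented by both of its orientations.\<close>

definition char_degree_graph :: "('a, 'b) monoid_scheme \<Rightarrow> nat pair_pre_digraph" where
  "char_degree_graph G =
     \<lparr> pverts = degree_primes G,
       parcs = {(p, q). p \<in> degree_primes G \<and> q \<in> degree_primes G \<and> p \<noteq> q \<and>
                        (\<exists>r\<in>cd G. p * q dvd r)} \<rparr>"

text \<open>In a symmetric digraph the degree of a vertex is its out-degree.\<close>

definition regular_graph :: "nat \<Rightarrow> 'v pair_pre_digraph \<Rightarrow> bool" where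
  "regular_graph k \<Gamma> \<longleftrightarrow> (\<forall>v\<in>pverts \<Gamma>. out_degree (with_proj \<Gamma>) v = k)"

text \<open>Row and column \<open>i\<close> belong to the \<open>i\<close>-th vertex in increasing order; another order of
  the vertices gives a similar matrix.\<close>

definition vertex :: "'v::linorder pair_pre_digraph \<Rightarrow> nat \<Rightarrow> 'v" where
  "vertex \<Gamma> i = sorted_list_of_set (pverts \<Gamma>) ! i"

definition degree_matrix :: "'v::linorder pair_pre_digraph \<Rightarrow> real mat" where
  "degree_matrix \<Gamma> = mat (card (pverts \<Gamma>)) (card (pverts \<Gamma>))
     (\<lambda>(i, j). if i = j then real (out_degree (with_proj \<Gamma>) (vertex \<Gamma> i)) else 0)"

definition adjacency_matrix :: "'v::linorder pair_pre_digraph \<Rightarrow> real mat" where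
  "adjacency_matrix \<Gamma> = mat (card (pverts \<Gamma>)) (card (pverts \<Gamma>))
     (\<lambda>(i, j). if (vertex \<Gamma> i, vertex \<Gamma> j) \<in> parcs \<Gamma> then 1 else 0)"

definition laplacian_matrix :: "'v::linorder pair_pre_digraph \<Rightarrow> real mat" where
  "laplacian_matrix \<Gamma> = degree_matrix \<Gamma> - adjacency_matrix \<Gamma>"

text \<open>The set of columns of the two-row array: each eigenvalue with its multiplicity as a root
  of the characteristic polynomial.\<close>

definition laplacian_spectrum :: "'v::linorder pair_pre_digraph \<Rightarrow> (real \<times> nat) set" where
  "laplacian_spectrum \<Gamma> =
     {(x, Polynomial.order x (char_poly (laplacian_matrix \<Gamma>))) | x.
        x \<in> spectrum (laplacian_matrix \<Gamma>)}"

lemma rep_character_one: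
  assumes "group G" "R \<in> hom G (GL d)"
  shows "rep_character G R \<one>\<^bsub>G\<^esub> = of_nat d"
proof -
  interpret M: ring "ring_mat TYPE(complex) d ()" by (rule ring_mat)
  have "group (GL d)"
    unfolding GL_def by (rule M.units_group)
  with assms have "R \<one>\<^bsub>G\<^esub> = \<one>\<^bsub>GL d\<^esub>"
    by (intro hom_one)
  then have "R \<one>\<^bsub>G\<^esub> = 1\<^sub>m d"
    by (simp add: GL_def units_of_one ring_mat_simps)
  then show ?thesis
    using assms(1) by (simp add: rep_character_def mat_trace_def group.is_monoid monoid.one_closed)
qed

lemma cd_eq:
  assumes "group G"
  shows "cd G = {d. \<exists>R. irreducible_rep G d R}"
proof -
  have *: "rep_character G R \<one>\<^bsub>G\<^esub> = of_nat d" if "irreducible_rep G d R" for d R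
    using that rep_character_one[OF assms] unfolding irreducible_rep_def by blast
  show ?thesis
  proof (intro equalityI subsetI)
    fix m assume "m \<in> cd G"
    then obtain R d where R: "irreducible_rep G d R"
        and "rep_character G R \<one>\<^bsub>G\<^esub> = of_nat m"
      unfolding cd_def Irr_def by blast
    with *[OF R] have "d = m"
      by simp
    with R show "m \<in> {d. \<exists>R. irreducible_rep G d R}"
      by blast
  qed (use * in \<open>unfold cd_def Irr_def, blast\<close>)
qed

lemma pair_graph_char_degree_graph:
  assumes "finite (degree_primes G)"
  shows "pair_graph (char_degree_graph G)"
proof
  show "finite (parcs (char_degree_graph G))"
    by (rule finite_subset[of _ "degree_primes G \<times> degree_primes G"])
       (auto simp: char_degree_graph_def assms)
  show "symmetric (with_proj (char_degree_graph G))"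
    by (auto simp: symmetric_def arcs_ends_def arc_to_ends_def char_degree_graph_def
        with_proj_def sym_def image_iff mult.commute)
qed (auto simp: char_degree_graph_def assms)

end

theory Submission
  imports Defs
begin

text \<open>Each vertex of an \<open>(n - 2)\<close>-regular graph on \<open>n\<close> vertices has exactly one other vertex that
  it is not adjacent to, so the complement is a perfect matching and \<open>n = 2 * m\<close>. Listing one vertex
  of each matching pair first and then their partners in the same order, the Laplacian becomes
  \<open>(A, B; B, A)\<close> with \<open>A = (n - 1) I - J\<close> and \<open>B = I - J\<close>, where \<open>J\<close> is the all-ones matrix of
  size \<open>m\<close>. Its characteristic polynomial is the product of those of \<open>A + B = n I - 2 J\<close> and
  \<open>A - B = (n - 2) I\<close>.\<close>

section \<open>Characteristic polynomials of relabelled, block and scalar-plus-constant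
  matrices\<close>

text \<open>Relabelling permutes the rows and then the columns of the characteristic matrix, and
  since \<open>p\<close> is injective the diagonal stays the diagonal. Columns are permuted as rows
  of the transpose. Each permutation contributes a factor \<open>signof p\<close>, and the two signs
  cancel.\<close>

lemma char_poly_permute:
  fixes A :: "'a::comm_ring_1 mat"
  assumes A: "A \<in> carrier_mat n n" and p: "p permutes {0..<n}"
  shows "char_poly (mat n n (\<lambda>(i, j). A $$ (p i, p j))) = char_poly A"
proof -
  let ?M = "char_poly_matrix A"
  let ?R = "mat n n (\<lambda>(i, j). ?M $$ (p i, j))"
  have lt: "p i < n \<longleftrightarrow> i < n" for i
    using permutes_in_image[OF p, of i] by simp
  have inj: "p i = p j \<longleftrightarrow> i = j" for i j
    using permutes_inj[OF p] by (auto dest: injD)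
  have M: "?M \<in> carrier_mat n n" using A by simp
  have "char_poly_matrix (mat n n (\<lambda>(i, j). A $$ (p i, p j)))
      = transpose_mat (mat n n (\<lambda>(i, j). transpose_mat ?R $$ (p i, j)))"
    using A by (intro eq_matI) (auto simp: char_poly_matrix_def lt inj)
  then have "char_poly (mat n n (\<lambda>(i, j). A $$ (p i, p j)))
      = det (mat n n (\<lambda>(i, j). transpose_mat ?R $$ (p i, j)))"
    by (simp add: char_poly_def det_transpose[of _ n])
  also have "\<dots> = signof p * det (transpose_mat ?R)"
    by (rule det_permute_rows[OF _ p]) simp
  also have "det (transpose_mat ?R) = signof p * det ?M"
    using det_permute_rows[OF M p] by (simp add: det_transpose[of _ n])
  also have "signof p * (signof p * det ?M) = det ?M"
    by (simp add: sign_def)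
  finally show ?thesis by (simp add: char_poly_def)
qed

text \<open>The indeterminate occurs only in the diagonal blocks of the characteristic matrix, so
  the zero block stays zero and the determinant factors.\<close>

lemma char_poly_four_block_mat_lower_left_zero:
  fixes A :: "'a::idom mat"
  assumes A: "A \<in> carrier_mat n n" and B: "B \<in> carrier_mat n m" and D: "D \<in> carrier_mat m m"
  shows "char_poly (four_block_mat A B (0\<^sub>m m n) D) = char_poly A * char_poly D"
proof -
  have "char_poly_matrix (four_block_mat A B (0\<^sub>m m n) D)
      = four_block_mat (char_poly_matrix A) (map_mat (\<lambda>a. [:- a:]) B) (0\<^sub>m m n) (char_poly_matrix D)"
    using A B D by (intro eq_matI) (auto simp: char_poly_matrix_def)
  then show ?thesis
    unfolding char_poly_def
    using det_four_block_mat_lower_left_zero[of "char_poly_matrix A" n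
        "map_mat (\<lambda>a. [:- a:]) B" m "0\<^sub>m m n" "char_poly_matrix D"] A B D
    by simp
qed

text \<open>The vectors \<open>(x, x)\<close> form an invariant subspace on which the matrix acts as
  \<open>A + B\<close>, and it acts on the quotient as \<open>A - B\<close>. Taking
  \<open>(x, x)\<close> and \<open>(0, x)\<close> as block basis, instead of \<open>(x, x)\<close>
  and \<open>(x, -x)\<close>, gives only a triangular form but avoids dividing by 2.\<close>

lemma char_poly_four_block_mat_symmetric:
  fixes A :: "'a::idom mat"
  assumes A: "A \<in> carrier_mat n n" and B: "B \<in> carrier_mat n n"
  shows "char_poly (four_block_mat A B B A) = char_poly (A + B) * char_poly (A - B)"
proof -
  let ?T = "four_block_mat (A + B) B (0\<^sub>m n n) (A - B)"
  let ?P = "four_block_mat (1\<^sub>m n) (0\<^sub>m n n) (1\<^sub>m n) (1\<^sub>m n) :: 'a mat"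
  let ?Q = "four_block_mat (1\<^sub>m n) (0\<^sub>m n n) (- 1\<^sub>m n) (1\<^sub>m n) :: 'a mat"
  have neg: "X * - 1\<^sub>m n = - X" if "X \<in> carrier_mat n n" for X :: "'a mat"
    using that uminus_mult_right_mat[of X "1\<^sub>m n"] by simp
  have PQ: "?P * ?Q = 1\<^sub>m (n + n)"
    by (subst mult_four_block_mat[of _ n n _ n _ n _ _ n _ n])
       (auto intro!: eq_matI)
  have QP: "?Q * ?P = 1\<^sub>m (n + n)"
    by (subst mult_four_block_mat[of _ n n _ n _ n _ _ n _ n])
       (auto intro!: eq_matI)
  have "?P * ?T = four_block_mat (A + B) B (A + B) A"
    using A B
    by (subst mult_four_block_mat[of _ n n _ n _ n _ _ n _ n])
       (auto intro!: cong_four_block_mat)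
  \<comment> \<open>Multiplication by \<open>?Q\<close> on the right subtracts the second block
    column from the first.\<close>
  then have PTQ: "four_block_mat A B B A = ?P * ?T * ?Q"
    using A B
    by (simp, subst mult_four_block_mat[of _ n n _ n _ n _ _ n _ n])
       (auto simp: neg intro!: cong_four_block_mat)
  have "similar_mat (four_block_mat A B B A) ?T"
    using A B by (intro similar_matI[OF _ PQ QP PTQ]) auto
  then have "char_poly (four_block_mat A B B A) = char_poly ?T"
    by (rule char_poly_similar)
  also have "\<dots> = char_poly (A + B) * char_poly (A - B)"
    using A B by (intro char_poly_four_block_mat_lower_left_zero) auto
  finally show ?thesis .
qed

lemma char_poly_scalar_mat:
  "char_poly (c \<cdot>\<^sub>m 1\<^sub>m n :: 'a::comm_ring_1 mat) = [:- c, 1:] ^ n"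
proof -
  have "diag_mat (c \<cdot>\<^sub>m 1\<^sub>m n :: 'a mat) = replicate n c"
    by (auto simp: diag_mat_def list_eq_iff_nth_eq)
  then show ?thesis
    by (subst char_poly_upper_triangular[of _ n]) auto
qed

text \<open>Conjugating by the matrix whose first column is the all-ones vector, which is an
  eigenvector, splits off the eigenvalue \<open>c + n * d\<close>.\<close>

lemma char_poly_scalar_plus_const_mat:
  fixes c d :: "'a::idom"
  assumes "n > 0"
  shows "char_poly (mat n n (\<lambda>(i, j). (if i = j then c else 0) + d))
           = [:- (c + of_nat n * d), 1:] * [:- c, 1:] ^ (n - 1)"
proof -
  let ?A = "mat n n (\<lambda>(i, j). (if i = j then c else 0) + d)"
  \<comment> \<open>This is \<open>?A\<close> in the basis of columns of \<open>?P\<close>: the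
    all-ones vector is scaled by \<open>c + of_nat n * d\<close>, and every other basis vector goes
    to \<open>c\<close> times itself plus \<open>d\<close> times the all-ones vector, which fills
    the rest of row 0 with \<open>d\<close>.\<close>
  let ?T = "mat n n (\<lambda>(i, j). (if i = j then c else 0) +
    (if i = 0 then if j = 0 then of_nat n * d else d else 0))"
  let ?P = "mat n n (\<lambda>(i, j). if i = j \<or> j = 0 then 1 else 0) :: 'a mat"
  let ?Q = "mat n n (\<lambda>(i, j). if i = j then 1 else if j = 0 then - 1 else 0) :: 'a mat"
  \<comment> \<open>Closed forms for a row of \<open>?A\<close>, \<open>?P\<close> or
    \<open>?Q\<close> applied to a vector \<open>f\<close>; the matrix products below are computed
    entrywise from them.\<close>
  have sumA: "(\<Sum>l = 0..<n. ((if i = l then c else 0) + d) * f l) = c * f i + d * (\<Sum>l = 0..<n. f l)"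
    if "i < n" for i and f :: "nat \<Rightarrow> 'a"
    using that
    by (simp add: distrib_right sum.distrib sum_distrib_left if_distrib[of "\<lambda>x. x * _"] cong: if_cong)
  have sumP: "(\<Sum>l = 0..<n. (if i = l \<or> l = 0 then 1 else 0) * f l) = f i + (if i = 0 then 0 else f 0)"
    if "i < n" for i and f :: "nat \<Rightarrow> 'a"
  proof -
    have "(\<Sum>l = 0..<n. (if i = l \<or> l = 0 then 1 else 0) * f l)
        = (\<Sum>l = 0..<n. (if i = l then f l else 0) + (if 0 = l then (if i = 0 then 0 else f 0) else 0))"
      by (intro sum.cong) auto
    with that show ?thesis by (simp add: sum.distrib)
  qed
  have sumQ: "(\<Sum>l = 0..<n. (if i = l then 1 else if l = 0 then - 1 else 0) * f l)
      = f i - (if i = 0 then 0 else f 0)"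
    if "i < n" for i and f :: "nat \<Rightarrow> 'a"
  proof -
    have "(\<Sum>l = 0..<n. (if i = l then 1 else if l = 0 then - 1 else 0) * f l)
        = (\<Sum>l = 0..<n. (if i = l then f l else 0) - (if 0 = l then (if i = 0 then 0 else f 0) else 0))"
      by (intro sum.cong) auto
    with that show ?thesis by (simp add: sum_subtractf)
  qed
  have colP: "(\<Sum>l = 0..<n. if l = j \<or> j = 0 then 1 else 0) = (if j = 0 then of_nat n else 1 :: 'a)"
    if "j < n" for j
    using that by auto
  have PQ: "?P * ?Q = 1\<^sub>m n"
    by (intro eq_matI) (auto simp: scalar_prod_def sumP)
  have QP: "?Q * ?P = 1\<^sub>m n"
    by (intro eq_matI) (auto simp: scalar_prod_def sumQ)
  have AP: "?A * ?P = ?P * ?T"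
    by (intro eq_matI) (simp_all add: scalar_prod_def sumA sumP colP mult.commute[of d])
  have "?A = ?A * (?P * ?Q)" by (simp add: PQ)
  also have "\<dots> = ?A * ?P * ?Q" by (rule assoc_mult_mat[symmetric, of _ n n _ n _ n]) auto
  finally have "?A = ?P * ?T * ?Q" unfolding AP .
  then have "similar_mat ?A ?T"
    by (intro similar_matI[OF _ PQ QP]) auto
  then have "char_poly ?A = char_poly ?T"
    by (rule char_poly_similar)
  also have "\<dots> = (\<Prod>a\<leftarrow>diag_mat ?T. [:- a, 1:])"
    by (rule char_poly_upper_triangular[of _ n]) auto
  also have "diag_mat ?T = (c + of_nat n * d) # replicate (n - 1) c"
    using assms by (auto simp: diag_mat_def list_eq_iff_nth_eq nth_Cons split: nat.split)
  finally show ?thesis by simp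
qed

section \<open>The perfect matching formed by the non-edges\<close>

text \<open>The smaller elements of the pairs \<open>{i, f i}\<close> form a set \<open>R\<close>
  that \<open>f\<close> exchanges with its complement, so \<open>R\<close> has \<open>m\<close>
  elements. An enumeration of \<open>R\<close> followed by the images under \<open>f\<close> is the
  required order.\<close>

lemma fixpoint_free_involution_pairing:
  fixes f :: "nat \<Rightarrow> nat"
  assumes f: "\<And>i. i < 2 * m \<Longrightarrow> f i < 2 * m \<and> f i \<noteq> i \<and> f (f i) = i"
  obtains p where "p permutes {0..<2 * m}" and "\<And>i. i < m \<Longrightarrow> p (i + m) = f (p i)"
proof -
  define R where "R = {i. i < 2 * m \<and> i < f i}"
  have fin: "finite R" by (simp add: R_def)
  have inj: "inj_on f {0..<2 * m}"
    using f by (metis atLeastLessThan_iff inj_onI)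
  have img: "f ` R = {0..<2 * m} - R"
  proof (intro equalityI subsetI)
    fix x assume "x \<in> f ` R"
    then obtain y where "y \<in> R" "x = f y" by blast
    then show "x \<in> {0..<2 * m} - R" using f[of y] by (simp add: R_def)
  next
    fix x assume x: "x \<in> {0..<2 * m} - R"
    then have "f x < 2 * m" "f x \<noteq> x" "f (f x) = x" "\<not> x < f x"
      using f[of x] by (simp_all add: R_def)
    then have "f x \<in> R" "x = f (f x)"
      by (auto simp: R_def)
    then show "x \<in> f ` R" by blast
  qed
  have "R \<subseteq> {0..<2 * m}" by (auto simp: R_def)
  then have "card (f ` R) = card R"
    by (intro card_image inj_on_subset[OF inj])
  moreover have "card (f ` R) = 2 * m - card R"
    using fin \<open>R \<subseteq> {0..<2 * m}\<close> by (simp add: img card_Diff_subset)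
  moreover have "card R \<le> 2 * m"
    using card_mono[OF _ \<open>R \<subseteq> {0..<2 * m}\<close>] by simp
  ultimately have "card R = m" by linarith
  with fin obtain e where e: "bij_betw e {0..<m} R"
    using ex_bij_betw_nat_finite by blast
  \<comment> \<open>The last case makes \<open>p\<close> the identity outside the index range, as
    \<open>permutes\<close> demands.\<close>
  define p where "p i = (if i < m then e i else if i < 2 * m then f (e (i - m)) else i)" for i
  have "bij_betw p {0..<m} R"
    by (rule bij_betw_cong[THEN iffD1, OF _ e]) (simp add: p_def)
  moreover have "bij_betw p {m..<2 * m} ({0..<2 * m} - R)"
  proof -
    have "bij_betw (\<lambda>i. i - m) {m..<2 * m} {0..<m}"
      by (rule bij_betw_byWitness[of _ "\<lambda>i. i + m"]) auto
    moreover have "bij_betw f R ({0..<2 * m} - R)"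
      unfolding img[symmetric] by (meson \<open>R \<subseteq> {0..<2 * m}\<close> bij_betw_imageI inj inj_on_subset)
    ultimately have "bij_betw (f \<circ> (e \<circ> (\<lambda>i. i - m))) {m..<2 * m} ({0..<2 * m} - R)"
      using e by (blast intro: bij_betw_trans)
    then show ?thesis
      by (rule bij_betw_cong[THEN iffD1, rotated]) (simp add: p_def)
  qed
  ultimately have "bij_betw p ({0..<m} \<union> {m..<2 * m}) (R \<union> ({0..<2 * m} - R))"
    by (rule bij_betw_combine) auto
  moreover have "{0..<m} \<union> {m..<2 * m} = {0..<2 * m}" "R \<union> ({0..<2 * m} - R) = {0..<2 * m}"
    using \<open>R \<subseteq> {0..<2 * m}\<close> by auto
  ultimately have "p permutes {0..<2 * m}"
    by (intro bij_imp_permutes) (auto simp: p_def)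
  moreover have "p (i + m) = f (p i)" if "i < m" for i
    using that by (simp add: p_def)
  ultimately show thesis by (rule that)
qed

lemma bij_betw_vertex:
  assumes "finite (pverts \<Gamma>)"
  shows "bij_betw (vertex \<Gamma>) {0..<card (pverts \<Gamma>)} (pverts \<Gamma>)"
  using assms bij_betw_nth[of "sorted_list_of_set (pverts \<Gamma>)" "{0..<card (pverts \<Gamma>)}" "pverts \<Gamma>"]
  by (simp add: vertex_def[abs_def] atLeast0LessThan)

text \<open>A vertex and its \<open>n - 2\<close> neighbours leave exactly one vertex over, its
  partner. Adjacency is symmetric, so being partners is too, and \<open>f\<close> is an
  involution.\<close>

lemma (in pair_graph) regular_partner:
  fixes n :: nat
  assumes n: "card (pverts G) = n" and "n \<ge> 2" and reg: "regular_graph (n - 2) G"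
    and v: "bij_betw v {0..<n} (pverts G)"
  obtains f where "\<And>i j. i < n \<Longrightarrow> j < n \<Longrightarrow> (v i, v j) \<in> parcs G \<longleftrightarrow> j \<noteq> i \<and> j \<noteq> f i"
    and "\<And>i. i < n \<Longrightarrow> f i < n \<and> f i \<noteq> i \<and> f (f i) = i"
proof -
  have inj: "v i = v j \<longleftrightarrow> i = j" if "i < n" "j < n" for i j
    using v that by (auto simp: bij_betw_def inj_on_def)
  have vV: "v i \<in> pverts G" if "i < n" for i
    using bij_betwE[OF v] that by simp
  have loop: "(v i, v i) \<notin> parcs G" for i
    using no_loops by force
  have sym: "(v i, v j) \<in> parcs G \<Longrightarrow> (v j, v i) \<in> parcs G" for i j
    using arcs_symmetric by blast
  have ex1: "\<exists>!j. j < n \<and> j \<noteq> i \<and> (v i, v j) \<notin> parcs G" if i: "i < n" for i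
  proof -
    let ?N = "{j. j < n \<and> (v i, v j) \<in> parcs G}"
    \<comment> \<open>Turns the out-degree into a count of indices.\<close>
    have "out_arcs (with_proj G) (v i) = (\<lambda>j. (v i, v j)) ` ?N"
    proof (intro equalityI subsetI)
      fix e assume "e \<in> out_arcs (with_proj G) (v i)"
      then have e: "e \<in> parcs G" "fst e = v i" by (simp_all add: with_proj_def)
      then have "snd e \<in> v ` {0..<n}"
        using v wellformed by (simp add: bij_betw_def)
      then obtain j where "j < n" "snd e = v j" by auto
      with e show "e \<in> (\<lambda>j. (v i, v j)) ` ?N"
        by (metis (mono_tags, lifting) imageI mem_Collect_eq prod.collapse)
    qed (auto simp: with_proj_def)
    moreover have "inj_on (\<lambda>j. (v i, v j)) ?N"
      by (auto simp: inj_on_def inj)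
    ultimately have "card ?N = out_degree (with_proj G) (v i)"
      by (simp add: out_degree_def card_image)
    then have "card ?N = n - 2"
      using reg vV[OF i] by (simp add: regular_graph_def)
    moreover have "i \<notin> ?N" using loop by simp
    \<comment> \<open>With \<open>n \<ge> 2\<close> the truncated subtraction is exact:
      \<open>(n - 2) + 1 = n - 1\<close>.\<close>
    ultimately have "card (insert i ?N) = n - 1"
      using \<open>n \<ge> 2\<close> by simp
    moreover have "{j. j < n \<and> j \<noteq> i \<and> (v i, v j) \<notin> parcs G} = {0..<n} - insert i ?N" by auto
    moreover have "insert i ?N \<subseteq> {0..<n}" using i by auto
    ultimately have "card {j. j < n \<and> j \<noteq> i \<and> (v i, v j) \<notin> parcs G} = 1"
      using \<open>n \<ge> 2\<close> by (simp add: card_Diff_subset finite_subset)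
    then obtain k where "{j. j < n \<and> j \<noteq> i \<and> (v i, v j) \<notin> parcs G} = {k}"
      by (rule card_1_singletonE)
    then have "j < n \<and> j \<noteq> i \<and> (v i, v j) \<notin> parcs G \<longleftrightarrow> j = k" for j
      by (simp add: set_eq_iff)
    then show ?thesis by simp
  qed
  define f where "f i = (THE j. j < n \<and> j \<noteq> i \<and> (v i, v j) \<notin> parcs G)" for i
  have f: "f i < n \<and> f i \<noteq> i \<and> (v i, v (f i)) \<notin> parcs G" if "i < n" for i
    unfolding f_def by (rule theI'[OF ex1[OF that]])
  have uniq: "j = f i" if "i < n" "j < n" "j \<noteq> i" "(v i, v j) \<notin> parcs G" for i j
    using that unfolding f_def by (intro the1_equality[OF ex1, symmetric]) auto
  show thesis
  proof
    show "(v i, v j) \<in> parcs G \<longleftrightarrow> j \<noteq> i \<and> j \<noteq> f i" if "i < n" "j < n" for i j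
      using that f[OF that(1)] uniq[OF that] loop[of i] by auto
    show "f i < n \<and> f i \<noteq> i \<and> f (f i) = i" if "i < n" for i
      using f[OF that] uniq[of "f i" i] sym[of "f i" i] that by (metis (full_types))
  qed
qed

section \<open>Laplacian of the cocktail party graph\<close>

text \<open>The cocktail party graph is the complete graph minus a perfect matching. The sorted
  vertex order need not respect the matching, so the Laplacian is first relabelled by
  \<open>p\<close>.\<close>

lemma char_poly_laplacian_cocktail_party:
  fixes \<Gamma> :: "'v::linorder pair_pre_digraph"
  assumes "pair_graph \<Gamma>" and n: "card (pverts \<Gamma>) = 2 * m" and m: "m > 0"
    and reg: "regular_graph (2 * m - 2) \<Gamma>"
  shows "char_poly (laplacian_matrix \<Gamma>)
           = [:0, 1:] * [:- (2 * real m), 1:] ^ (m - 1) * [:- (2 * real m - 2), 1:] ^ m"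
proof -
  interpret pair_graph \<Gamma> by fact
  let ?L = "laplacian_matrix \<Gamma>"
  have v: "bij_betw (vertex \<Gamma>) {0..<2 * m} (pverts \<Gamma>)"
    using bij_betw_vertex[of \<Gamma>] n by simp
  obtain f where adj: "\<And>i j. i < 2 * m \<Longrightarrow> j < 2 * m \<Longrightarrow>
        (vertex \<Gamma> i, vertex \<Gamma> j) \<in> parcs \<Gamma> \<longleftrightarrow> j \<noteq> i \<and> j \<noteq> f i"
      and f: "\<And>i. i < 2 * m \<Longrightarrow> f i < 2 * m \<and> f i \<noteq> i \<and> f (f i) = i"
    using regular_partner[OF n _ reg v] m by auto
  obtain p where p: "p permutes {0..<2 * m}" and pm: "\<And>i. i < m \<Longrightarrow> p (i + m) = f (p i)"
    using fixpoint_free_involution_pairing f by metis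
  have lt: "p i < 2 * m" if "i < 2 * m" for i
    using permutes_in_image[OF p, of i] that by simp
  have inj: "p i = p j \<longleftrightarrow> i = j" for i j
    using permutes_inj[OF p] by (auto dest: injD)
  have deg: "out_degree (with_proj \<Gamma>) (vertex \<Gamma> i) = 2 * m - 2" if "i < 2 * m" for i
    using reg bij_betwE[OF v] that by (simp add: regular_graph_def)
  have L: "?L $$ (i, j) = (if i = j then 2 * real m - 2 else if j = f i then 0 else - 1)"
    if "i < 2 * m" "j < 2 * m" for i j
    using that adj[OF that] deg[OF that(1)] m
    by (auto simp: laplacian_matrix_def degree_matrix_def adjacency_matrix_def n)
  \<comment> \<open>In the new order the matching pairs \<open>i\<close> with \<open>i + m\<close>;
    for indices in the second half this uses that \<open>f\<close> is an involution.\<close>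
  have fp: "f (p i) = p (if i < m then i + m else i - m)" if "i < 2 * m" for i
    using that pm[of i] pm[of "i - m"] f[OF lt, of "i - m"] by auto
  \<comment> \<open>The diagonal entries of \<open>?A\<close> are the degrees
    \<open>2 * m - 2\<close>; the diagonal of \<open>?B\<close> is zero because partners are not
    adjacent.\<close>
  let ?A = "mat m m (\<lambda>(i, j). (if i = j then 2 * real m - 1 else 0) + - 1)"
  let ?B = "mat m m (\<lambda>(i, j). if i = j then 0 else - 1 :: real)"
  have "mat (2 * m) (2 * m) (\<lambda>(i, j). ?L $$ (p i, p j)) = four_block_mat ?A ?B ?B ?A"
    by (intro eq_matI) (auto simp: L lt inj fp)
  moreover have "?L \<in> carrier_mat (2 * m) (2 * m)"
    by (auto simp: laplacian_matrix_def degree_matrix_def adjacency_matrix_def n)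
  ultimately have "char_poly ?L = char_poly (four_block_mat ?A ?B ?B ?A)"
    using char_poly_permute[OF _ p, of ?L] by simp
  also have "\<dots> = char_poly (?A + ?B) * char_poly (?A - ?B)"
    by (rule char_poly_four_block_mat_symmetric) auto
  also have "?A + ?B = mat m m (\<lambda>(i, j). (if i = j then 2 * real m else 0) + - 2)"
    by (intro eq_matI) auto
  \<comment> \<open>The all-ones vector has eigenvalue \<open>2 * m + m * (- 2) = 0\<close>.\<close>
  also have "char_poly \<dots> = [:0, 1:] * [:- (2 * real m), 1:] ^ (m - 1)"
    by (subst char_poly_scalar_plus_const_mat[OF m]) (simp add: mult.commute)
  also have "?A - ?B = (2 * real m - 2) \<cdot>\<^sub>m 1\<^sub>m m"
    by (intro eq_matI) auto
  also have "char_poly \<dots> = [:- (2 * real m - 2), 1:] ^ m"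
    by (rule char_poly_scalar_mat)
  finally show ?thesis .
qed

text \<open>For \<open>m \<ge> 2\<close> the roots 0, \<open>2 * m - 2\<close> and
  \<open>2 * m\<close> are distinct and all exponents are positive, so the multiplicities are the
  exponents. For \<open>m = 1\<close> the first two roots would coincide and the third would
  disappear.\<close>

lemma laplacian_spectrum_cocktail_party:
  fixes \<Gamma> :: "'v::linorder pair_pre_digraph"
  assumes "pair_graph \<Gamma>" and n: "card (pverts \<Gamma>) = 2 * m" and m: "m \<ge> 2"
    and "regular_graph (2 * m - 2) \<Gamma>"
  shows "laplacian_spectrum \<Gamma> = {(0, 1), (2 * real m - 2, m), (2 * real m, m - 1)}"
proof -
  let ?L = "laplacian_matrix \<Gamma>"
  have cp: "char_poly ?L = [:0, 1:] * [:- (2 * real m), 1:] ^ (m - 1) * [:- (2 * real m - 2), 1:] ^ m"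
    by (rule char_poly_laplacian_cocktail_party[OF assms(1) n _ assms(4)]) (use m in simp)
  have "?L \<in> carrier_mat (2 * m) (2 * m)"
    by (auto simp: laplacian_matrix_def degree_matrix_def adjacency_matrix_def n)
  then have spec: "spectrum ?L = {0, 2 * real m - 2, 2 * real m}"
    using m by (auto simp: spectrum_def eigenvalue_root_char_poly cp)
  \<comment> \<open>Orders add up over the factors; that the roots are distinct enters only in the
    last step.\<close>
  have "order x (char_poly ?L) = (if x = 0 then 1 else 0)
      + (if x = 2 * real m then m - 1 else 0) + (if x = 2 * real m - 2 then m else 0)" for x
    unfolding cp by (simp add: order_mult order_linear_power order_linear' del: mult_pCons_left)
  with spec m show ?thesis
    by (auto simp: laplacian_spectrum_def)
qed

theorem corollary3p4:
  fixes G :: "('a, 'b) monoid_scheme" and n :: nat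
  assumes "n \<ge> 4" and "even n"
    and "group G" and "finite (carrier G)" and "solvable G"
    and "card (pverts (char_degree_graph G)) = n"
    and "regular_graph (n - 2) (char_degree_graph G)"
  shows "laplacian_spectrum (char_degree_graph G) =
           {(0, 1), (real n - 2, n div 2), (real n, n div 2 - 1)}"
proof -
  have "card (degree_primes G) = n"
    using assms by (simp add: char_degree_graph_def)
  \<comment> \<open>An infinite set has \<open>card\<close> equal to 0, which
    \<open>n \<ge> 4\<close> excludes.\<close>
  then have "finite (degree_primes G)"
    using \<open>n \<ge> 4\<close> by (metis card.infinite not_numeral_le_zero)
  then have "pair_graph (char_degree_graph G)"
    by (rule pair_graph_char_degree_graph)
  then show ?thesis
    using laplacian_spectrum_cocktail_party[of "char_degree_graph G" "n div 2"] assms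
    by (auto elim!: evenE)
qed

end
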